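(* Let $S$ be a weakly cancellative Cu-semigroup satisfying (O5), and consider a sequence of Cu-morphisms $\varphi_i\colon \mathrm{Lsc}([0,1],\overline{\mathbb{N}})\to S$, $i\ge 1$, with $\varphi_i(1)=\varphi_{i+1}(1)$ for each $i$, such that $d(\varphi_i,\varphi_{i+1})<\epsilon_i$, where $(\epsilon_i)_i$ is strictly decreasing and $\sum_{i=1}^\infty\epsilon_i<\infty$. Then there exists a unique Cu-morphism $\varphi\colon\mathrm{Lsc}([0,1],\overline{\mathbb{N}})\to S$ with $d(\varphi,\varphi_i)\to 0$ and $\varphi(1)=\varphi_i(1)$ for every $i$.
   Context: A positively ordered monoid is a commutative monoid $S$ with a partial order compatible with addition such that $0\le x$ for all $x\in S$. For $x,y\in S$ write $x\ll y$ if for every increasing sequence $(z_n)_n$ in $S$ whose supremum exists and satisfies $y\le \sup_n z_n$, there is $n$ with $x\le z_n$. A Cu-semigroup is a positively ordered monoid $S$ such that: (O1) every increasing sequence in $S$ has a supremum; (O2) every element is the supremum of a $\ll$-increasing sequence; (O3) $x'\ll x$ and $y'\ll y$ imply $x'+y'\ll x+y$; (O4) $\sup_n x_n+\sup_n y_n=\sup_n(x_n+y_n)$ for all increasing sequences $(x_n)_n,(y_n)_n$. A Cu-morphism is a map between Cu-semigroups preserving $0$, addition, order, the relation $\ll$, and suprema of increasing sequences. (O5): whenever $x+y\le z$, $x'\ll x$ and $y'\ll y$, there exists $c$ with $x'+c\le z\le x+c$ and $y'\ll c$. Weak cancellation: $x+z\ll y+z$ implies $x\ll y$. $\overline{\mathbb{N}}=\{0,1,2,\dots\}\cup\{\infty\}$,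 and $\mathrm{Lsc}([0,1],\overline{\mathbb{N}})$ is the Cu-semigroup of lower-semicontinuous functions $[0,1]\to\overline{\mathbb{N}}$ with pointwise order and addition; $\chi_U$ is the indicator function of $U$ (with $\chi_{(t,1]}=0$ if $t\ge 1$), and $1$ is the constant function. Distance: for Cu-morphisms $\varphi_1,\varphi_2\colon \mathrm{Lsc}([0,1],\overline{\mathbb{N}})\to S$ with $\varphi_1(1)=\varphi_2(1)$, $d(\varphi_1,\varphi_2)$ is the infimum of all $\epsilon\in[0,1]$ such that $\varphi_1(\chi_{(t+\epsilon,1]})\le\varphi_2(\chi_{(t,1]})$ and $\varphi_2(\chi_{(t+\epsilon,1]})\le\varphi_1(\chi_{(t,1]})$ for all $t\in[0,1]$. *)

theory Defs
  imports "HOL-Analysis.Analysis" "HOL-Library.Extended_Nat"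
begin

section \<open>Cu-semigroups\<close>

class positively_ordered_monoid = ordered_comm_monoid_add +
  assumes pom_zero_le: "0 \<le> x"

context order
begin

definition is_supremum :: "(nat \<Rightarrow> 'a) \<Rightarrow> 'a \<Rightarrow> bool" where
  "is_supremum z s \<longleftrightarrow> (\<forall>n. z n \<le> s) \<and> (\<forall>u. (\<forall>n. z n \<le> u) \<longrightarrow> s \<le> u)"

definition way_below :: "'a \<Rightarrow> 'a \<Rightarrow> bool" (infix \<open>\<lless>\<close> 50) where
  "x \<lless> y \<longleftrightarrow> (\<forall>z s. monotone (\<le>) (\<le>) z \<longrightarrow> is_supremum z s \<longrightarrow> y \<le> s \<longrightarrow> (\<exists>n. x \<le> z n))"

end

class cu_semigroup = positively_ordered_monoid +
  assumes cu_O1: "monotone (\<le>) (\<le>) z \<Longrightarrow> \<exists>s. is_supremum z s"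
    and cu_O2: "\<exists>z. (\<forall>n. z n \<lless> z (Suc n)) \<and> is_supremum z x"
    and cu_O3: "x' \<lless> x \<Longrightarrow> y' \<lless> y \<Longrightarrow> x' + y' \<lless> x + y"
    and cu_O4: "monotone (\<le>) (\<le>) z \<Longrightarrow> monotone (\<le>) (\<le>) w \<Longrightarrow> is_supremum z s \<Longrightarrow> is_supremum w t \<Longrightarrow>
      is_supremum (\<lambda>n. z n + w n) (s + t)"

definition cu_morphism :: "('a::cu_semigroup \<Rightarrow> 'b::cu_semigroup) \<Rightarrow> bool" where
  "cu_morphism \<phi> \<longleftrightarrow>
     \<phi> 0 = 0 \<and>
     (\<forall>x y. \<phi> (x + y) = \<phi> x + \<phi> y) \<and>
     (\<forall>x y. x \<le> y \<longrightarrow> \<phi> x \<le> \<phi> y) \<and>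
     (\<forall>x y. x \<lless> y \<longrightarrow> \<phi> x \<lless> \<phi> y) \<and>
     (\<forall>z s. incseq z \<longrightarrow> is_supremum z s \<longrightarrow> is_supremum (\<lambda>n::nat. \<phi> (z n)) (\<phi> s))"

definition satisfies_O5 :: "'a::cu_semigroup itself \<Rightarrow> bool" where
  "satisfies_O5 _ \<longleftrightarrow>
     (\<forall>x x' y y' z :: 'a. x + y \<le> z \<longrightarrow> x' \<lless> x \<longrightarrow> y' \<lless> y \<longrightarrow>
        (\<exists>c. x' + c \<le> z \<and> z \<le> x + c \<and> y' \<lless> c))"

definition weakly_cancellative :: "'a::cu_semigroup itself \<Rightarrow> bool" where
  "weakly_cancellative _ \<longleftrightarrow> (\<forall>x y z :: 'a. x + z \<lless> y + z \<longrightarrow> x \<lless> y)"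


section \<open>The Cu-semigroup of lower-semicontinuous functions on the unit interval\<close>

definition lower_semicontinuous_on :: "real set \<Rightarrow> (real \<Rightarrow> enat) \<Rightarrow> bool" where
  "lower_semicontinuous_on X f \<longleftrightarrow> (\<forall>a. openin (top_of_set X) {x \<in> X. a < f x})"

text \<open>Functions on the unit interval are represented by functions on the reals that vanish
  outside of it, so that equality, order and addition are pointwise.\<close>

typedef lsc01 = "{f :: real \<Rightarrow> enat. lower_semicontinuous_on {0..1} f \<and> (\<forall>x. x \<notin> {0..1} \<longrightarrow> f x = 0)}"
  morphisms lsc_fun Abs_lsc01
  by (rule exI[of _ "\<lambda>_. 0"]) (auto simp: lower_semicontinuous_on_def)

setup_lifting type_definition_lsc01

lemma lsc_onI:
  assumes "\<And>x a. x \<in> {0..1} \<Longrightarrow> a < f x \<Longrightarrow> \<exists>d>0. \<forall>y\<in>{0..1}. dist y x < d \<longrightarrow> a < f y"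
  shows "lower_semicontinuous_on {0..1} f"
  unfolding lower_semicontinuous_on_def openin_euclidean_subtopology_iff
  using assms by (auto simp: subset_iff)

lemma lsc_onD:
  assumes "lower_semicontinuous_on {0..1} f" "x \<in> {0..1}" "a < f x"
  obtains d where "d > 0" "\<And>y. y \<in> {0..1} \<Longrightarrow> dist y x < d \<Longrightarrow> a < f y"
proof -
  have "openin (top_of_set {0..1}) {x \<in> {0..1}. a < f x}"
    using assms(1) unfolding lower_semicontinuous_on_def by blast
  with assms(2,3) show ?thesis
    unfolding openin_euclidean_subtopology_iff using that by blast
qed

lemma enat_not_less_imp_zero: "\<not> enat v \<le> a \<Longrightarrow> \<exists>m. a = enat m \<and> m < v"
  by (cases a) auto

lemma lsc_on_leD:
  assumes "lower_semicontinuous_on {0..1} f" "x \<in> {0..1}" "enat v \<le> f x"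
  obtains d where "d > 0" "\<And>y. y \<in> {0..1} \<Longrightarrow> dist y x < d \<Longrightarrow> enat v \<le> f y"
proof (cases v)
  case 0
  then show ?thesis using that[of 1] by (simp add: zero_enat_def[symmetric])
next
  case (Suc m)
  with assms(3) have "enat m < f x" by (simp add: Suc_ile_eq)
  from lsc_onD[OF assms(1,2) this] obtain d
    where "d > 0" "\<And>y. y \<in> {0..1} \<Longrightarrow> dist y x < d \<Longrightarrow> enat m < f y" by blast
  with Suc show ?thesis using that[of d] by (simp add: Suc_ile_eq)
qed

lemma lsc_on_leI:
  assumes "\<And>x v. x \<in> {0..1} \<Longrightarrow> enat v \<le> f x \<Longrightarrow> \<exists>d>0. \<forall>y\<in>{0..1}. dist y x < d \<longrightarrow> enat v \<le> f y"
  shows "lower_semicontinuous_on {0..1} f"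
proof (rule lsc_onI)
  fix x :: real and a assume x: "x \<in> {0..1}" and a: "a < f x"
  then obtain m where m: "a = enat m" by (cases a) auto
  with a have "enat (Suc m) \<le> f x" by (simp add: Suc_ile_eq)
  from assms[OF x this] show "\<exists>d>0. \<forall>y\<in>{0..1}. dist y x < d \<longrightarrow> a < f y"
    by (simp add: Suc_ile_eq m)
qed

lemma enat_le_SUP_iff:
  fixes f :: "nat \<Rightarrow> enat"
  assumes "enat v \<le> (SUP n. f n)"
  shows "\<exists>n. enat v \<le> f n"
proof (cases v)
  case 0
  then show ?thesis by (simp add: zero_enat_def[symmetric])
next
  case (Suc m)
  with assms have "enat m < (SUP n. f n)" by (simp add: Suc_ile_eq)
  then show ?thesis unfolding less_SUP_iff Suc by (auto simp: Suc_ile_eq)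
qed

lemma enat_leI: "(\<And>v. enat v \<le> a \<Longrightarrow> enat v \<le> b) \<Longrightarrow> a \<le> b"
proof (rule ccontr)
  assume *: "\<And>v. enat v \<le> a \<Longrightarrow> enat v \<le> b" and "\<not> a \<le> b"
  then obtain m where "b = enat m" "b < a" by (cases b) auto
  with *[of "Suc m"] show False by (simp add: Suc_ile_eq)
qed

instantiation lsc01 :: "{zero, one, plus, order}"
begin

lift_definition zero_lsc01 :: lsc01 is "\<lambda>_. 0"
  by (auto simp: lower_semicontinuous_on_def)

lift_definition one_lsc01 :: lsc01 is "indicator {0..1}"
  by (auto simp: indicator_def intro!: lsc_onI exI[of _ "1::real"])

lift_definition plus_lsc01 :: "lsc01 \<Rightarrow> lsc01 \<Rightarrow> lsc01" is "\<lambda>f g x. f x + g x"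
proof (intro conjI lsc_on_leI, goal_cases)
  case (1 f g x v)
  obtain i j where ij: "enat i \<le> f x" "enat j \<le> g x" "v \<le> i + j"
  proof (cases "enat v \<le> f x \<or> enat v \<le> g x")
    case True
    then show ?thesis using that[of v 0] that[of 0 v] by (auto simp: zero_enat_def[symmetric])
  next
    case False
    then obtain i j where "f x = enat i" "g x = enat j"
      by (meson enat_not_less_imp_zero)
    with 1(4) show ?thesis using that[of i j] by auto
  qed
  obtain d where d: "d > 0" "\<And>y. y \<in> {0..1} \<Longrightarrow> dist y x < d \<Longrightarrow> enat i \<le> f y"
    using lsc_on_leD[where f = f, OF _ 1(3) ij(1)] 1(1) by blast
  obtain e where e: "e > 0" "\<And>y. y \<in> {0..1} \<Longrightarrow> dist y x < e \<Longrightarrow> enat j \<le> g y"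
    using lsc_on_leD[where f = g, OF _ 1(3) ij(2)] 1(2) by blast
  have "enat v \<le> f y + g y" if "y \<in> {0..1}" "dist y x < min d e" for y
  proof -
    have "enat v \<le> enat i + enat j" using ij(3) by simp
    also have "\<dots> \<le> f y + g y" using d(2) e(2) that by (intro add_mono) auto
    finally show ?thesis .
  qed
  then show ?case using d(1) e(1) by (intro exI[of _ "min d e"]) auto
qed auto

lift_definition less_eq_lsc01 :: "lsc01 \<Rightarrow> lsc01 \<Rightarrow> bool" is "\<lambda>f g. \<forall>x. f x \<le> g x" .

definition less_lsc01 :: "lsc01 \<Rightarrow> lsc01 \<Rightarrow> bool" where
  "less_lsc01 f g \<longleftrightarrow> f \<le> g \<and> \<not> g \<le> f"

instance
proof
  fix f g h :: lsc01
  show "f < g \<longleftrightarrow> f \<le> g \<and> \<not> g \<le> f" by (fact less_lsc01_def)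
  show "f \<le> f" by transfer simp
  show "f \<le> g \<Longrightarrow> g \<le> h \<Longrightarrow> f \<le> h" by transfer (blast intro: order_trans)
  show "f \<le> g \<Longrightarrow> g \<le> f \<Longrightarrow> f = g" by transfer (auto intro: antisym)
qed

end

instance lsc01 :: positively_ordered_monoid
proof
  fix f g h :: lsc01
  show "f + g + h = f + (g + h)" by transfer (simp add: add.assoc)
  show "f + g = g + f" by transfer (simp add: add.commute)
  show "0 + f = f" by transfer simp
  show "f \<le> g \<Longrightarrow> h + f \<le> h + g" by transfer (simp add: add_left_mono)
  show "0 \<le> f" by transfer simp
qed

lift_definition lsc_SUP :: "(nat \<Rightarrow> lsc01) \<Rightarrow> lsc01" is "\<lambda>z x. SUP n. z n x"
proof (intro conjI lsc_on_leI, goal_cases)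
  case (1 z x v)
  obtain n where n: "enat v \<le> z n x" using enat_le_SUP_iff[OF 1(3)] by blast
  obtain d where d: "d > 0" "\<And>y. y \<in> {0..1} \<Longrightarrow> dist y x < d \<Longrightarrow> enat v \<le> z n y"
    using lsc_on_leD[where f = "z n", OF _ 1(2) n] 1(1) by blast
  then show ?case by (intro exI[of _ d]) (auto intro!: SUP_upper2[of n])
qed auto

lemma is_supremum_lsc_SUP: "is_supremum z (lsc_SUP z)"
  unfolding is_supremum_def less_eq_lsc01.rep_eq lsc_SUP.rep_eq by (auto intro: SUP_upper SUP_least)

lemma is_supremum_lsc01_iff: "is_supremum z s \<longleftrightarrow> s = lsc_SUP z"
  using is_supremum_lsc_SUP[of z] unfolding is_supremum_def by (blast intro: antisym)

lemma way_below_lscI: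
  assumes "\<And>p. p \<in> {0..1} \<Longrightarrow>
    \<exists>d>0. \<exists>v. enat v \<le> lsc_fun g p \<and> (\<forall>q\<in>{0..1}. dist q p < d \<longrightarrow> lsc_fun f q \<le> enat v)"
  shows "f \<lless> g"
  unfolding way_below_def is_supremum_lsc01_iff
proof safe
  fix z :: "nat \<Rightarrow> lsc01" assume z: "incseq z" and g: "g \<le> lsc_SUP z"
  have "\<exists>d>0. \<exists>k. \<forall>q\<in>{0..1}. dist q p < d \<longrightarrow> lsc_fun f q \<le> lsc_fun (z k) q"
    if p: "p \<in> {0..1}" for p
  proof -
    obtain d v where d: "d > 0" and v: "enat v \<le> lsc_fun g p"
      and f: "\<And>q. q \<in> {0..1} \<Longrightarrow> dist q p < d \<Longrightarrow> lsc_fun f q \<le> enat v"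
      using assms[OF p] by blast
    have "enat v \<le> (SUP n. lsc_fun (z n) p)"
      using v g by (metis less_eq_lsc01.rep_eq lsc_SUP.rep_eq order_trans)
    then obtain k where k: "enat v \<le> lsc_fun (z k) p" using enat_le_SUP_iff by blast
    obtain e where e: "e > 0" "\<And>y. y \<in> {0..1} \<Longrightarrow> dist y p < e \<Longrightarrow> enat v \<le> lsc_fun (z k) y"
      using lsc_on_leD[where f = "lsc_fun (z k)", OF _ p k] lsc_fun[of "z k"] by blast
    show ?thesis
      using d e(1) order_trans[OF f e(2)] by (intro exI[of _ "min d e"] conjI exI[of _ k]) auto
  qed
  then obtain d k where d: "\<And>p. p \<in> {0..1} \<Longrightarrow> d p > 0"
    and k: "\<And>p q. p \<in> {0..1} \<Longrightarrow> q \<in> {0..1} \<Longrightarrow> dist q p < d p \<Longrightarrow> lsc_fun f q \<le> lsc_fun (z (k p)) q"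
    by metis
  have "{0..1::real} \<subseteq> (\<Union>p\<in>{0..1}. ball p (d p))" using d by force
  then obtain C where C: "C \<subseteq> {0..1}" "finite C" "{0..1::real} \<subseteq> (\<Union>p\<in>C. ball p (d p))"
    using compactE_image[of "{0..1::real}" "{0..1}" "\<lambda>p. ball p (d p)"] by auto
  have "lsc_fun f q \<le> lsc_fun (z (Max (k ` C))) q" for q
  proof (cases "q \<in> {0..1}")
    case True
    with C(3) have "q \<in> (\<Union>p\<in>C. ball p (d p))" by blast
    then obtain p where "p \<in> C" "q \<in> ball p (d p)" by blast
    then have p: "p \<in> C" "dist q p < d p" by (simp_all add: dist_commute)
    have "lsc_fun f q \<le> lsc_fun (z (k p)) q" using k p C(1) True by blast
    also have "lsc_fun (z (k p)) q \<le> lsc_fun (z (Max (k ` C))) q"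
      using incseqD[OF z Max_ge[of "k ` C" "k p"]] p(1) C(2) by (simp only: finite_imageI imageI less_eq_lsc01.rep_eq)
    finally show ?thesis .
  next
    case False
    then show ?thesis using lsc_fun[of f] by simp
  qed
  then show "\<exists>n. f \<le> z n" by (auto simp: less_eq_lsc01.rep_eq)
qed

lemma compact_dist_greater:
  fixes x :: "'b::heine_borel"
  assumes "compact C" "\<forall>c\<in>C. r < dist x c"
  shows "\<exists>d>0. \<forall>y. dist y x < d \<longrightarrow> (\<forall>c\<in>C. r < dist y c)"
proof (cases "C = {}")
  case True
  then show ?thesis by (intro exI[of _ 1]) simp
next
  case False
  then obtain c where c: "c \<in> C" "\<And>b. b \<in> C \<Longrightarrow> dist x c \<le> dist x b"
    using distance_attains_inf[of C x] assms(1) compact_imp_closed by blast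
  have "r < dist y b" if "dist y x < dist x c - r" "b \<in> C" for y b
    using c(2)[OF that(2)] dist_triangle[of x b y] dist_commute[of x y] that(1) by linarith
  moreover have "dist x c - r > 0" using assms(2) c(1) by simp
  ultimately show ?thesis by blast
qed

lift_definition lsc_approx :: "lsc01 \<Rightarrow> nat \<Rightarrow> lsc01" is
  "\<lambda>f n x. if x \<in> {0..1} then min (enat n) (INF y\<in>{y\<in>{0..1}. dist x y \<le> inverse (real (Suc n))}. f y) else 0"
proof (intro conjI lsc_on_leI, goal_cases)
  case (1 f n x v)
  let ?r = "inverse (real (Suc n))"
  let ?C = "{0..1} \<inter> {y. \<not> enat v \<le> f y}"
  have "enat v \<le> min (enat n) (INF y\<in>{y\<in>{0..1}. dist x y \<le> ?r}. f y)"
    using 1(3) unfolding if_P[OF 1(2)] .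
  then have vn: "enat v \<le> enat n"
    and v_INF: "enat v \<le> (INF y\<in>{y\<in>{0..1}. dist x y \<le> ?r}. f y)"
    unfolding min.bounded_iff by blast+
  have fx: "enat v \<le> f y" if "y \<in> {0..1}" "dist x y \<le> ?r" for y
    by (rule order_trans[OF v_INF INF_lower]) (use that in blast)
  have "compact ?C"
  proof -
    have "openin (top_of_set {0..1}) {y\<in>{0..1}. enat v \<le> f y}"
      unfolding openin_euclidean_subtopology_iff
    proof (intro conjI ballI)
      fix y assume y: "y \<in> {y\<in>{0..1}. enat v \<le> f y}"
      then obtain d where "d > 0" "\<And>w. w \<in> {0..1} \<Longrightarrow> dist w y < d \<Longrightarrow> enat v \<le> f w"
        using lsc_on_leD[where f = f and x = y and v = v] 1(1) by blast
      then show "\<exists>e>0. \<forall>x'\<in>{0..1}. dist x' y < e \<longrightarrow> x' \<in> {y\<in>{0..1}. enat v \<le> f y}" by blast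
    qed blast
    then have "closedin (top_of_set {0..1}) ({0..1} - {y\<in>{0..1}. enat v \<le> f y})"
      by (simp add: closedin_diff)
    moreover have "{0..1} - {y\<in>{0..1}. enat v \<le> f y} = ?C" by auto
    ultimately show ?thesis using closedin_compact[of "{0..1::real}"] by simp
  qed
  moreover have "\<forall>c\<in>?C. ?r < dist x c" using fx by force
  ultimately obtain d where d: "d > 0" "\<forall>y. dist y x < d \<longrightarrow> (\<forall>c\<in>?C. ?r < dist y c)"
    using compact_dist_greater[of ?C ?r x] by blast
  have "enat v \<le> f w" if "dist y x < d" "w \<in> {0..1}" "dist y w \<le> ?r" for y w
  proof (rule ccontr)
    assume "\<not> enat v \<le> f w"
    with that(2) have "w \<in> ?C" by blast
    with d(2) that(1) have "?r < dist y w" by blast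
    with that(3) show False by linarith
  qed
  then have "enat v \<le> (INF w\<in>{w\<in>{0..1}. dist y w \<le> ?r}. f w)" if "dist y x < d" for y
    using that by (intro INF_greatest) blast
  then have "\<forall>y\<in>{0..1}. dist y x < d \<longrightarrow>
      enat v \<le> min (enat n) (INF w\<in>{w\<in>{0..1}. dist y w \<le> ?r}. f w)"
    by (intro ballI impI min.boundedI[OF vn])
  then show ?case using d(1) by (intro exI[of _ d]) (simp only: if_True simp_thms cong: ball_cong)
next
  case (2 f n)
  show ?case by (intro allI impI if_not_P)
qed

lemma lsc_approx_le:
  assumes "p \<in> {0..1}" "q \<in> {0..1}" "dist q p \<le> inverse (real (Suc n))"
  shows "lsc_fun (lsc_approx f n) q \<le> min (enat n) (lsc_fun f p)"
proof -
  have "(INF y\<in>{y\<in>{0..1}. dist q y \<le> inverse (real (Suc n))}. lsc_fun f y) \<le> lsc_fun f p"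
    using assms by (intro INF_lower) simp
  then show ?thesis
    unfolding lsc_approx.rep_eq using assms(2) by (simp only: if_True min.mono order_refl)
qed

lemma lsc_approx_way_below_Suc: "lsc_approx f n \<lless> lsc_approx f (Suc n)"
proof (rule way_below_lscI)
  fix p :: real assume p: "p \<in> {0..1}"
  let ?r = "\<lambda>n. inverse (real (Suc n))"
  let ?m = "\<lambda>k. min (enat n) (INF y\<in>{y\<in>{0..1}. dist p y \<le> ?r k}. lsc_fun f y)"
  define d where "d = ?r n - ?r (Suc n)"
  have d: "d > 0" by (simp add: d_def)
  obtain v where v: "?m (Suc n) = enat v" by (cases "?m (Suc n)") (auto simp: min_def split: if_splits)
  have "enat v \<le> lsc_fun (lsc_approx f (Suc n)) p"
    unfolding v[symmetric] lsc_approx.rep_eq using p by (auto intro: min.coboundedI1)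
  moreover have "lsc_fun (lsc_approx f n) q \<le> enat v" if "q \<in> {0..1}" "dist q p < d" for q
  proof -
    have "dist q y \<le> ?r n" if "dist p y \<le> ?r (Suc n)" for y
      using dist_triangle[of q y p] that \<open>dist q p < d\<close> unfolding d_def by linarith
    then have "(INF y\<in>{y\<in>{0..1}. dist q y \<le> ?r n}. lsc_fun f y) \<le>
        (INF y\<in>{y\<in>{0..1}. dist p y \<le> ?r (Suc n)}. lsc_fun f y)"
      by (intro INF_superset_mono) auto
    then show ?thesis
      unfolding v[symmetric] lsc_approx.rep_eq using that(1)
      by (simp only: if_True min.mono order_refl)
  qed
  ultimately show "\<exists>d>0. \<exists>v. enat v \<le> lsc_fun (lsc_approx f (Suc n)) p \<and>
      (\<forall>q\<in>{0..1}. dist q p < d \<longrightarrow> lsc_fun (lsc_approx f n) q \<le> enat v)"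
    using d by blast
qed

lemma way_below_imp_le: "x \<lless> y \<Longrightarrow> x \<le> y"
  unfolding way_below_def is_supremum_def
  by (drule spec[of _ "\<lambda>_. y"], drule spec[of _ y]) (auto simp: incseq_def)

lemma lsc_approx_incseq: "incseq (lsc_approx f)"
  by (intro incseq_SucI way_below_imp_le lsc_approx_way_below_Suc)

lemma lsc_SUP_approx: "lsc_SUP (lsc_approx f) = f"
proof (rule antisym)
  show "lsc_SUP (lsc_approx f) \<le> f"
    unfolding less_eq_lsc01.rep_eq
  proof
    fix x show "lsc_fun (lsc_SUP (lsc_approx f)) x \<le> lsc_fun f x"
      unfolding lsc_SUP.rep_eq
    proof (rule SUP_least)
      fix n show "lsc_fun (lsc_approx f n) x \<le> lsc_fun f x"
      proof (cases "x \<in> {0..1}")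
        case True
        then show ?thesis using lsc_approx_le[of x x n f] by simp
      qed (auto simp: lsc_approx.rep_eq)
    qed
  qed
  show "f \<le> lsc_SUP (lsc_approx f)"
    unfolding less_eq_lsc01.rep_eq lsc_SUP.rep_eq
  proof
    fix x show "lsc_fun f x \<le> (SUP n. lsc_fun (lsc_approx f n) x)"
    proof (cases "x \<in> {0..1}")
      case True
      show ?thesis
      proof (rule enat_leI)
        fix v assume v: "enat v \<le> lsc_fun f x"
        obtain d where d: "d > 0" "\<And>y. y \<in> {0..1} \<Longrightarrow> dist y x < d \<Longrightarrow> enat v \<le> lsc_fun f y"
          using lsc_on_leD[where f = "lsc_fun f", OF _ True v] lsc_fun[of f] by blast
        obtain k where k: "inverse (real (Suc k)) < d" using reals_Archimedean[OF d(1)] by blast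
        define n where "n = max k v"
        have "inverse (real (Suc n)) \<le> inverse (real (Suc k))"
          by (intro le_imp_inverse_le) (auto simp: n_def)
        with k have n: "inverse (real (Suc n)) < d" by linarith
        have "enat v \<le> lsc_fun (lsc_approx f n) x"
        proof -
          have "enat v \<le> (INF y\<in>{y\<in>{0..1}. dist x y \<le> inverse (real (Suc n))}. lsc_fun f y)"
          proof (rule INF_greatest)
            fix y assume "y \<in> {y\<in>{0..1}. dist x y \<le> inverse (real (Suc n))}"
            then have "y \<in> {0..1}" "dist y x < d" using n by (simp_all add: dist_commute)
            then show "enat v \<le> lsc_fun f y" by (rule d(2))
          qed
          moreover have "enat v \<le> enat n" by (simp add: n_def)
          ultimately show ?thesis unfolding lsc_approx.rep_eq using True by (simp only: if_True min.bounded_iff)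
        qed
        then show "enat v \<le> (SUP n. lsc_fun (lsc_approx f n) x)" by (rule SUP_upper2[OF UNIV_I])
      qed
    next
      case False
      then show ?thesis using lsc_fun[of f] by simp
    qed
  qed
qed

lemma way_below_lsc_approxD: "f \<lless> g \<Longrightarrow> \<exists>n. f \<le> lsc_approx g n"
  unfolding way_below_def is_supremum_lsc01_iff
  using lsc_approx_incseq lsc_SUP_approx by (metis order_refl)

lemma le_way_below_trans: "x \<le> y \<Longrightarrow> y \<lless> z \<Longrightarrow> x \<lless> z"
  unfolding way_below_def by (meson order_trans)

instance lsc01 :: cu_semigroup
proof
  fix z :: "nat \<Rightarrow> lsc01"
  show "\<exists>s. is_supremum z s" using is_supremum_lsc_SUP by blast
next
  fix x :: lsc01
  show "\<exists>z. (\<forall>n. z n \<lless> z (Suc n)) \<and> is_supremum z x"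
    by (intro exI[of _ "lsc_approx x"])
      (simp add: lsc_approx_way_below_Suc is_supremum_lsc01_iff lsc_SUP_approx)
next
  fix x x' y y' :: lsc01
  assume "x' \<lless> x" "y' \<lless> y"
  then obtain m n where mn: "x' \<le> lsc_approx x m" "y' \<le> lsc_approx y n"
    using way_below_lsc_approxD by blast
  have "lsc_approx x m + lsc_approx y n \<lless> x + y"
  proof (rule way_below_lscI)
    fix p :: real assume p: "p \<in> {0..1}"
    let ?d = "min (inverse (real (Suc m))) (inverse (real (Suc n)))"
    obtain i where i: "min (enat m) (lsc_fun x p) = enat i"
      by (cases "min (enat m) (lsc_fun x p)") (auto simp: min_def split: if_splits)
    obtain j where j: "min (enat n) (lsc_fun y p) = enat j"
      by (cases "min (enat n) (lsc_fun y p)") (auto simp: min_def split: if_splits)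
    have "enat (i + j) \<le> lsc_fun (x + y) p"
      unfolding plus_lsc01.rep_eq plus_enat_simps(1)[symmetric] i[symmetric] j[symmetric]
      by (intro add_mono) auto
    moreover have "lsc_fun (lsc_approx x m + lsc_approx y n) q \<le> enat (i + j)"
      if "q \<in> {0..1}" "dist q p < ?d" for q
      unfolding plus_lsc01.rep_eq plus_enat_simps(1)[symmetric] i[symmetric] j[symmetric]
      using that p by (intro add_mono lsc_approx_le) auto
    moreover have "?d > 0" by simp
    ultimately show "\<exists>d>0. \<exists>v. enat v \<le> lsc_fun (x + y) p \<and>
        (\<forall>q\<in>{0..1}. dist q p < d \<longrightarrow> lsc_fun (lsc_approx x m + lsc_approx y n) q \<le> enat v)"
      by blast
  qed
  then show "x' + y' \<lless> x + y" using le_way_below_trans add_mono[OF mn] by blast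
next
  fix z w :: "nat \<Rightarrow> lsc01" and s t
  assume zw: "incseq z" "incseq w"
    and st: "is_supremum z s" "is_supremum w t"
  have "lsc_fun (s + t) x = (SUP n. lsc_fun (z n + w n) x)" for x
  proof -
    have inc: "incseq (\<lambda>n. lsc_fun (z n) x)" "incseq (\<lambda>n. lsc_fun (w n) x)"
      using zw by (auto simp: incseq_def less_eq_lsc01.rep_eq)
    have "(\<lambda>n. lsc_fun (z n) x + lsc_fun (w n) x) \<longlonglongrightarrow>
        (SUP n. lsc_fun (z n) x) + (SUP n. lsc_fun (w n) x)"
      by (intro tendsto_add LIMSEQ_SUP inc)
    moreover have "(\<lambda>n. lsc_fun (z n) x + lsc_fun (w n) x) \<longlonglongrightarrow>
        (SUP n. lsc_fun (z n) x + lsc_fun (w n) x)"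
      using inc by (intro LIMSEQ_SUP) (auto simp: incseq_def intro!: add_mono)
    ultimately show ?thesis
      using st LIMSEQ_unique by (auto simp: is_supremum_lsc01_iff plus_lsc01.rep_eq lsc_SUP.rep_eq)
  qed
  then show "is_supremum (\<lambda>n. z n + w n) (s + t)"
    unfolding is_supremum_lsc01_iff by (intro lsc_fun_inject[THEN iffD1] ext) (simp add: lsc_SUP.rep_eq)
qed


section \<open>The distance between Cu-morphisms\<close>

text \<open>The indicator function of \<open>(t,1]\<close>, as a subset of the unit interval.\<close>

lift_definition chi :: "real \<Rightarrow> lsc01" is "\<lambda>t. indicator ({t<..1} \<inter> {0..1})"
proof (intro conjI lsc_onI, goal_cases)
  case (1 t x a)
  then have "t < x" "a < 1" by (cases "t < x"; simp add: indicator_def)+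
  then show ?case
    by (intro exI[of _ "x - t"]) (auto simp: indicator_def dist_real_def)
qed (auto simp: indicator_def)

definition cu_dist :: "(lsc01 \<Rightarrow> 's::cu_semigroup) \<Rightarrow> (lsc01 \<Rightarrow> 's) \<Rightarrow> real" where
  "cu_dist \<phi> \<psi> = Inf {e \<in> {0..1}. \<forall>t\<in>{0..1}.
     \<phi> (chi (t + e)) \<le> \<psi> (chi t) \<and> \<psi> (chi (t + e)) \<le> \<phi> (chi t)}"

end

theory Submission
  imports Defs
begin

text \<open>Weak cancellation makes closeness on the functions \<open>chi t\<close> control all values: a function
  \<open>f'\<close> way below \<open>f\<close> lies below a grid approximation, which is the difference of an increasing step
  function \<open>P\<close> and another one \<open>N\<close>, both sums of functions \<open>chi t\<close>; comparing \<open>P\<close> and \<open>N\<close> under two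
  close morphisms and cancelling \<open>N\<close> gives \<open>\<phi> f' \<le> \<psi> f\<close>. Hence the \<open>\<phi> i\<close> form a Cauchy sequence in
  the sense that \<open>\<phi> i f' \<le> \<phi> j f\<close> for all large \<open>i\<close> and \<open>j\<close>, and the limit takes \<open>f\<close> to the least upper
  bound of the elements that are eventually below \<open>\<phi> i f'\<close> for some such \<open>f'\<close>. The same comparison
  shows uniqueness.\<close>

section \<open>Limits of Cu-morphisms\<close>

lemma way_below_le_trans: "x \<lless> y \<Longrightarrow> y \<le> z \<Longrightarrow> x \<lless> z"
  unfolding way_below_def by (meson order_trans)

lemma way_belowD: "x \<lless> y \<Longrightarrow> incseq z \<Longrightarrow> is_supremum z s \<Longrightarrow> y \<le> s \<Longrightarrow> \<exists>n. x \<le> z n"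
  unfolding way_below_def by blast

lemma way_below_approximation:
  obtains z where "\<And>n. z n \<lless> z (Suc n)" "\<And>n. z n \<lless> x" "incseq z"
    "is_supremum z (x :: 'a::cu_semigroup)"
proof -
  obtain z where z: "\<And>n. z n \<lless> z (Suc n)" "is_supremum z x"
    using cu_O2[of x] by blast
  moreover have "z n \<lless> x" for n
    using z way_below_le_trans unfolding is_supremum_def by blast
  moreover have "incseq z"
    using z(1) by (intro incseq_SucI way_below_imp_le)
  ultimately show ?thesis using that by blast
qed

text \<open>Some member of an approximating sequence of \<open>y\<close> dominates \<open>x\<close>;
  the next member serves as \<open>z\<close>.\<close>

lemma way_below_interpolate:
  assumes "x \<lless> (y :: 'a::cu_semigroup)"
  obtains z where "x \<lless> z" "z \<lless> y"
  using way_below_approximation[of y] way_belowD[OF assms] le_way_below_trans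
  by (metis order_refl)

lemma zero_way_below: "0 \<lless> (x :: 'a::cu_semigroup)"
  unfolding way_below_def by (simp add: pom_zero_le)

lemma sum_way_below:
  "finite A \<Longrightarrow> (\<And>i. i \<in> A \<Longrightarrow> f i \<lless> g i) \<Longrightarrow> sum f A \<lless> (sum g A :: 'a::cu_semigroup)"
  by (induction A rule: finite_induct) (auto intro: zero_way_below cu_O3)

lemma cu_morphism_mono: "cu_morphism \<phi> \<Longrightarrow> x \<le> y \<Longrightarrow> \<phi> x \<le> \<phi> y"
  and cu_morphism_add: "cu_morphism \<phi> \<Longrightarrow> \<phi> (x + y) = \<phi> x + \<phi> y"
  and cu_morphism_zero: "cu_morphism \<phi> \<Longrightarrow> \<phi> 0 = 0"
  by (simp_all add: cu_morphism_def)

lemma cu_morphism_sum: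
  assumes "cu_morphism \<phi>"
  shows "\<phi> (sum f A) = (\<Sum>i\<in>A. \<phi> (f i))"
  by (induction A rule: infinite_finite_induct) (simp_all add: cu_morphism_zero[OF assms] cu_morphism_add[OF assms])

section \<open>Pointwise limit of a Cauchy sequence of Cu-morphisms\<close>

context
  fixes \<phi> :: "nat \<Rightarrow> 'a::cu_semigroup \<Rightarrow> 'b::cu_semigroup"
  assumes morphism: "\<And>i. cu_morphism (\<phi> i)"
    and cauchy: "\<And>x' x. x' \<lless> x \<Longrightarrow> \<exists>N. \<forall>i\<ge>N. \<forall>j\<ge>N. \<phi> i x' \<le> \<phi> j x"
begin

text \<open>A witness \<open>x'\<close> way below \<open>x\<close>, in place of a bound by
  \<open>\<phi> i x\<close>, leaves the gap in which \<open>cauchy\<close> can compare different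
  indices.\<close>

definition lower_values :: "'a \<Rightarrow> 'b set" where
  "lower_values x = {u. \<exists>x'. x' \<lless> x \<and> (\<forall>\<^sub>F i in sequentially. u \<le> \<phi> i x')}"

text \<open>Only increasing sequences are guaranteed suprema, so the bound is taken along a diagonal
  sequence \<open>y\<close> that lies in \<open>lower_values x\<close> and is cofinal in it.\<close>

lemma ex_lub_lower_values:
  "\<exists>s. (\<forall>u\<in>lower_values x. u \<le> s) \<and> (\<forall>v. (\<forall>u\<in>lower_values x. u \<le> v) \<longrightarrow> s \<le> v)"
proof -
  obtain z where z: "\<And>n. z n \<lless> z (Suc n)" "\<And>n. z n \<lless> x" "incseq z" "is_supremum z x"
    using way_below_approximation[of x] by metis
  obtain N where N: "\<And>n i j. i \<ge> N n \<Longrightarrow> j \<ge> N n \<Longrightarrow> \<phi> i (z n) \<le> \<phi> j (z (Suc n))"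
    using cauchy[OF z(1)] by metis
  \<comment> \<open>Partial sums put both \<open>m n\<close> and \<open>m (Suc n)\<close> beyond
    \<open>N n\<close>, so that \<open>y n\<close> and \<open>y (Suc n)\<close> can be
    compared.\<close>
  define m where "m n = (\<Sum>k\<le>n. N k)" for n
  have m: "N n \<le> m n" "N n \<le> m (Suc n)" for n
    unfolding m_def by (simp_all add: member_le_sum trans_le_add1)
  define y where "y n = \<phi> (m n) (z n)" for n
  have "incseq y"
    unfolding y_def by (intro incseq_SucI N m)
  then obtain s where s: "is_supremum y s"
    using cu_O1 by blast
  show ?thesis
  proof (intro exI[of _ s] conjI ballI allI impI)
    fix u assume "u \<in> lower_values x"
    then obtain x' where x': "x' \<lless> x" "\<forall>\<^sub>F i in sequentially. u \<le> \<phi> i x'"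
      unfolding lower_values_def by blast
    obtain n where n: "x' \<le> z n"
      using way_belowD[OF x'(1) z(3,4)] by blast
    obtain i where i: "u \<le> \<phi> i x'" "i \<ge> N n"
      using eventually_happens'[OF _ eventually_conj[OF x'(2) eventually_ge_at_top[of "N n"]]]
      by auto
    have "u \<le> \<phi> i (z n)"
      using i(1) cu_morphism_mono[OF morphism n] by (rule order_trans)
    also have "\<dots> \<le> y (Suc n)"
      unfolding y_def by (intro N i m)
    also have "\<dots> \<le> s"
      using s unfolding is_supremum_def by blast
    finally show "u \<le> s" .
  next
    fix v assume v: "\<forall>u\<in>lower_values x. u \<le> v"
    have "y n \<in> lower_values x" for n
      unfolding lower_values_def y_def eventually_sequentially using z(2) N m(1) by blast
    then show "s \<le> v"
      using s v unfolding is_supremum_def by blast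
  qed
qed

definition cu_lim :: "'a \<Rightarrow> 'b" where
  "cu_lim x = (SOME s. (\<forall>u\<in>lower_values x. u \<le> s) \<and>
     (\<forall>v. (\<forall>u\<in>lower_values x. u \<le> v) \<longrightarrow> s \<le> v))"

lemma cu_lim_upper: "u \<in> lower_values x \<Longrightarrow> u \<le> cu_lim x"
  and cu_lim_least: "(\<And>u. u \<in> lower_values x \<Longrightarrow> u \<le> v) \<Longrightarrow> cu_lim x \<le> v"
  using someI_ex[OF ex_lub_lower_values[of x]] unfolding cu_lim_def by blast+

text \<open>For large \<open>i\<close>, \<open>\<phi> i x'\<close> is itself a lower value of
  \<open>x\<close>, witnessed by an interpolated \<open>w\<close>. Together with the converse bound
  that follows, this transfers properties of the \<open>\<phi> i\<close> to the limit through a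
  single large index.\<close>

lemma eventually_le_cu_lim:
  assumes "x' \<lless> x"
  shows "\<forall>\<^sub>F i in sequentially. \<phi> i x' \<le> cu_lim x"
proof -
  obtain w where w: "x' \<lless> w" "w \<lless> x"
    by (rule way_below_interpolate[OF assms])
  obtain N where N: "\<And>i j. i \<ge> N \<Longrightarrow> j \<ge> N \<Longrightarrow> \<phi> i x' \<le> \<phi> j w"
    using cauchy[OF w(1)] by blast
  have "\<phi> i x' \<in> lower_values x" if "i \<ge> N" for i
    unfolding lower_values_def eventually_sequentially using N[OF that] w(2) by blast
  then show ?thesis
    unfolding eventually_sequentially using cu_lim_upper by blast
qed

lemma eventually_cu_lim_le:
  assumes "x' \<lless> x"
  shows "\<forall>\<^sub>F i in sequentially. cu_lim x' \<le> \<phi> i x"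
proof -
  obtain N where N: "\<And>i j. i \<ge> N \<Longrightarrow> j \<ge> N \<Longrightarrow> \<phi> i x' \<le> \<phi> j x"
    using cauchy[OF assms] by blast
  have "cu_lim x' \<le> \<phi> i x" if i: "i \<ge> N" for i
  proof (rule cu_lim_least)
    fix u assume "u \<in> lower_values x'"
    then obtain w where w: "w \<lless> x'" "\<forall>\<^sub>F j in sequentially. u \<le> \<phi> j w"
      unfolding lower_values_def by blast
    obtain j where j: "u \<le> \<phi> j w" "j \<ge> N"
      using eventually_happens'[OF _ eventually_conj[OF w(2) eventually_ge_at_top[of N]]] by auto
    show "u \<le> \<phi> i x"
      using j(1) cu_morphism_mono[OF morphism[of j] way_below_imp_le[OF w(1)]] N[OF j(2) i] by order
  qed
  then show ?thesis
    unfolding eventually_sequentially by blast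
qed

text \<open>By interpolation every lower value of \<open>x\<close> is already below
  \<open>cu_lim w\<close> for some \<open>w \<lless> x\<close>. This is the source of the
  preservation of suprema.\<close>

lemma cu_lim_leI:
  assumes "\<And>x'. x' \<lless> x \<Longrightarrow> cu_lim x' \<le> v"
  shows "cu_lim x \<le> v"
proof (rule cu_lim_least)
  fix u assume "u \<in> lower_values x"
  then obtain x' where x': "x' \<lless> x" "\<forall>\<^sub>F i in sequentially. u \<le> \<phi> i x'"
    unfolding lower_values_def by blast
  obtain w where w: "x' \<lless> w" "w \<lless> x"
    by (rule way_below_interpolate[OF x'(1)])
  obtain i where "u \<le> \<phi> i x'" "\<phi> i x' \<le> cu_lim w"
    using eventually_happens'[OF _ eventually_conj[OF x'(2) eventually_le_cu_lim[OF w(1)]]] by auto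
  then show "u \<le> v"
    using assms[OF w(2)] by order
qed

lemma cu_lim_mono: "x \<le> y \<Longrightarrow> cu_lim x \<le> cu_lim y"
  by (rule cu_lim_least, rule cu_lim_upper) (auto simp: lower_values_def intro: way_below_le_trans)

lemma cu_lim_way_below:
  assumes "x \<lless> y"
  shows "cu_lim x \<lless> cu_lim y"
proof -
  obtain w where w: "x \<lless> w" "w \<lless> y"
    by (rule way_below_interpolate[OF assms])
  obtain v where v: "w \<lless> v" "v \<lless> y"
    by (rule way_below_interpolate[OF w(2)])
  obtain i where i: "cu_lim x \<le> \<phi> i w" "\<phi> i v \<le> cu_lim y"
    using eventually_happens'[OF _ eventually_conj[OF eventually_cu_lim_le[OF w(1)]
      eventually_le_cu_lim[OF v(2)]]] by auto
  have "\<phi> i w \<lless> \<phi> i v"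
    using morphism[of i] v(1) by (auto simp: cu_morphism_def)
  then show ?thesis
    using i le_way_below_trans way_below_le_trans by blast
qed

lemma cu_lim_supremum:
  assumes z: "incseq z" "is_supremum z s"
  shows "is_supremum (\<lambda>n. cu_lim (z n)) (cu_lim s)"
  unfolding is_supremum_def
proof (intro conjI allI impI)
  show "cu_lim (z n) \<le> cu_lim s" for n
    using z(2) unfolding is_supremum_def by (blast intro: cu_lim_mono)
next
  fix v assume v: "\<forall>n. cu_lim (z n) \<le> v"
  show "cu_lim s \<le> v"
  proof (rule cu_lim_leI)
    fix x' assume "x' \<lless> s"
    then obtain n where "x' \<le> z n"
      using way_belowD z by blast
    then show "cu_lim x' \<le> v"
      using cu_lim_mono v by (blast intro: order_trans)
  qed
qed

text \<open>Both sides are suprema along approximations of \<open>x\<close> and \<open>y\<close>.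
  The terms are compared at one index \<open>i\<close>, where \<open>\<phi> i\<close> is additive,
  at the cost of passing from \<open>n\<close> to \<open>Suc n\<close>.\<close>

lemma cu_lim_add: "cu_lim (x + y) = cu_lim x + cu_lim y"
proof -
  obtain z where z: "\<And>n. z n \<lless> z (Suc n)" "\<And>n. z n \<lless> x" "incseq z" "is_supremum z x"
    using way_below_approximation[of x] by metis
  obtain w where w: "\<And>n. w n \<lless> w (Suc n)" "\<And>n. w n \<lless> y" "incseq w" "is_supremum w y"
    using way_below_approximation[of y] by metis
  have inc: "incseq (\<lambda>n. z n + w n)" "incseq (\<lambda>n. cu_lim (z n))" "incseq (\<lambda>n. cu_lim (w n))"
    using z(3) w(3) by (auto simp: incseq_def intro: add_mono cu_lim_mono)
  have sup: "is_supremum (\<lambda>n. cu_lim (z n + w n)) (cu_lim (x + y))"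
    by (intro cu_lim_supremum inc cu_O4 z w)
  have sup': "is_supremum (\<lambda>n. cu_lim (z n) + cu_lim (w n)) (cu_lim x + cu_lim y)"
    by (intro cu_lim_supremum inc cu_O4 z w)
  have "cu_lim (z n + w n) \<le> cu_lim x + cu_lim y" for n
  proof -
    have "\<forall>\<^sub>F i in sequentially. cu_lim (z n + w n) \<le> \<phi> i (z (Suc n) + w (Suc n)) \<and>
        \<phi> i (z (Suc n)) \<le> cu_lim x \<and> \<phi> i (w (Suc n)) \<le> cu_lim y"
      by (intro eventually_conj eventually_cu_lim_le eventually_le_cu_lim cu_O3 z w)
    then obtain i where "cu_lim (z n + w n) \<le> \<phi> i (z (Suc n) + w (Suc n))"
        "\<phi> i (z (Suc n)) \<le> cu_lim x" "\<phi> i (w (Suc n)) \<le> cu_lim y"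
      using eventually_happens'[of sequentially] by auto
    then show ?thesis
      unfolding cu_morphism_add[OF morphism] by (meson add_mono order_trans)
  qed
  moreover have "cu_lim (z n) + cu_lim (w n) \<le> cu_lim (x + y)" for n
  proof -
    have "\<forall>\<^sub>F i in sequentially. cu_lim (z n) \<le> \<phi> i (z (Suc n)) \<and>
        cu_lim (w n) \<le> \<phi> i (w (Suc n)) \<and> \<phi> i (z (Suc n) + w (Suc n)) \<le> cu_lim (x + y)"
      by (intro eventually_conj eventually_cu_lim_le eventually_le_cu_lim cu_O3 z w)
    then obtain i where "cu_lim (z n) \<le> \<phi> i (z (Suc n))"
        "cu_lim (w n) \<le> \<phi> i (w (Suc n))" "\<phi> i (z (Suc n) + w (Suc n)) \<le> cu_lim (x + y)"
      using eventually_happens'[of sequentially] by auto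
    then show ?thesis
      unfolding cu_morphism_add[OF morphism] by (meson add_mono order_trans)
  qed
  ultimately show ?thesis
    using sup sup' unfolding is_supremum_def by (blast intro: antisym)
qed

lemma cu_lim_zero: "cu_lim 0 = 0"
proof -
  obtain i where "cu_lim 0 \<le> \<phi> i 0"
    using eventually_happens'[OF _ eventually_cu_lim_le[OF zero_way_below]] by auto
  moreover have "\<phi> i 0 = 0"
    by (rule cu_morphism_zero[OF morphism])
  ultimately show ?thesis
    using pom_zero_le[of "cu_lim 0"] by simp
qed

lemma cu_morphism_cu_lim: "cu_morphism cu_lim"
  unfolding cu_morphism_def
  using cu_lim_zero cu_lim_add cu_lim_mono cu_lim_way_below cu_lim_supremum by blast

end

section \<open>Closeness on indicator functions\<close>

text \<open>For negative \<open>t\<close>, \<open>chi t\<close> is the constant function 1; letting \<open>t\<close> range over all reals therefore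
  includes \<open>\<phi> 1 = \<psi> 1\<close>.\<close>

definition chi_close :: "real \<Rightarrow> (lsc01 \<Rightarrow> 's::cu_semigroup) \<Rightarrow> (lsc01 \<Rightarrow> 's) \<Rightarrow> bool" where
  "chi_close e \<phi> \<psi> \<longleftrightarrow> (\<forall>t. \<phi> (chi (t + e)) \<le> \<psi> (chi t) \<and> \<psi> (chi (t + e)) \<le> \<phi> (chi t))"

lemma lsc_fun_chi: "x \<in> {0..1} \<Longrightarrow> lsc_fun (chi t) x = (if t < x then 1 else 0)"
  unfolding chi.rep_eq by (auto simp: indicator_def)

lemma lsc01_leI: "(\<And>x. x \<in> {0..1} \<Longrightarrow> lsc_fun f x \<le> lsc_fun g x) \<Longrightarrow> f \<le> g"
proof (unfold less_eq_lsc01.rep_eq, intro allI)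
  fix x assume "\<And>x. x \<in> {0..1} \<Longrightarrow> lsc_fun f x \<le> lsc_fun g x"
  then show "lsc_fun f x \<le> lsc_fun g x"
    using lsc_fun[of f] by (cases "x \<in> {0..1}") simp_all
qed

lemma chi_antimono: "s \<le> t \<Longrightarrow> chi t \<le> chi s"
  by (rule lsc01_leI) (auto simp: lsc_fun_chi)

lemma chi_neg: "t < 0 \<Longrightarrow> chi t = 1"
  by (rule antisym; rule lsc01_leI) (auto simp: lsc_fun_chi one_lsc01.rep_eq)

lemma chi_ge_1: "1 \<le> t \<Longrightarrow> chi t = 0"
  by (rule antisym; rule lsc01_leI) (auto simp: lsc_fun_chi zero_lsc01.rep_eq)

lemma chi_le_1: "chi t \<le> 1"
  by (rule lsc01_leI) (auto simp: lsc_fun_chi one_lsc01.rep_eq)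

text \<open>\<open>chi t\<close> is at most 1, and it vanishes near each point where
  \<open>chi s\<close> is 0.\<close>

lemma chi_way_below:
  assumes "s < t"
  shows "chi t \<lless> chi s"
proof (rule way_below_lscI)
  fix p :: real assume p: "p \<in> {0..1}"
  show "\<exists>d>0. \<exists>v. enat v \<le> lsc_fun (chi s) p \<and>
      (\<forall>q\<in>{0..1}. dist q p < d \<longrightarrow> lsc_fun (chi t) q \<le> enat v)"
  proof (cases "s < p")
    case True
    then show ?thesis
      using p by (intro exI[of _ 1] conjI) (auto simp: lsc_fun_chi one_enat_def)
  next
    case False
    then show ?thesis
      using p assms by (intro exI[of _ "t - s"] conjI exI[of _ 0])
        (auto simp: lsc_fun_chi zero_enat_def[symmetric] dist_real_def)
  qed
qed

lemma chi_close_sym: "chi_close e \<phi> \<psi> \<Longrightarrow> chi_close e \<psi> \<phi>"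
  unfolding chi_close_def by blast

lemma chi_close_trans:
  assumes "chi_close d \<phi> \<psi>" "chi_close e \<psi> \<theta>"
  shows "chi_close (d + e) \<phi> \<theta>"
  unfolding chi_close_def
proof (intro allI conjI)
  fix t
  show "\<phi> (chi (t + (d + e))) \<le> \<theta> (chi t)"
    using assms unfolding chi_close_def by (metis add.assoc add.commute order_trans)
  show "\<theta> (chi (t + (d + e))) \<le> \<phi> (chi t)"
    using assms unfolding chi_close_def by (metis add.assoc order_trans)
qed

lemma chi_close_mono:
  assumes "chi_close d \<phi> \<psi>" "d \<le> e" "cu_morphism \<phi>" "cu_morphism \<psi>"
  shows "chi_close e \<phi> \<psi>"
proof -
  have "\<phi> (chi (t + e)) \<le> \<phi> (chi (t + d))" "\<psi> (chi (t + e)) \<le> \<psi> (chi (t + d))" for t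
    using assms(2) by (simp_all add: cu_morphism_mono[OF assms(3)] cu_morphism_mono[OF assms(4)] chi_antimono)
  then show ?thesis
    using assms(1) unfolding chi_close_def by (meson order_trans)
qed

lemma chi_close_refl: "cu_morphism \<phi> \<Longrightarrow> chi_close 0 \<phi> \<phi>"
  by (simp add: chi_close_def)

text \<open>The infimum need not be attained, but some admissible \<open>d\<close> lies below
  \<open>e\<close>. For \<open>t < 0\<close> the bounds follow from equality at 1, and for
  \<open>t > 1\<close> all terms vanish.\<close>

lemma chi_close_if_cu_dist_less:
  assumes "cu_dist \<phi> \<psi> < e" "\<phi> 1 = \<psi> 1" "cu_morphism \<phi>" "cu_morphism \<psi>"
  shows "chi_close e \<phi> \<psi>"
proof -
  have mono: "\<phi> x \<le> \<phi> y" "\<psi> x \<le> \<psi> y" if "x \<le> y" for x y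
    using that by (simp_all add: cu_morphism_mono[OF assms(3)] cu_morphism_mono[OF assms(4)])
  have zero: "\<phi> 0 = 0" "\<psi> 0 = 0"
    using assms(3,4) by (simp_all add: cu_morphism_zero)
  let ?E = "{e \<in> {0..1}. \<forall>t\<in>{0..1}. \<phi> (chi (t + e)) \<le> \<psi> (chi t) \<and> \<psi> (chi (t + e)) \<le> \<phi> (chi t)}"
  have "1 \<in> ?E"
    using zero by (auto simp: chi_ge_1 pom_zero_le)
  then obtain d where d: "d \<in> ?E" "d < e"
    using assms(1) cInf_lessD[of ?E e] unfolding cu_dist_def by blast
  have "chi_close d \<phi> \<psi>"
    unfolding chi_close_def
  proof (rule allI)
    fix t :: real
    consider "t < 0" | "t \<in> {0..1}" | "1 < t" by force
    then show "\<phi> (chi (t + d)) \<le> \<psi> (chi t) \<and> \<psi> (chi (t + d)) \<le> \<phi> (chi t)"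
    proof cases
      case 1
      then show ?thesis
        using mono[OF chi_le_1] assms(2) by (simp add: chi_neg)
    next
      case 3
      with d show ?thesis by (simp add: chi_ge_1 zero)
    qed (use d in blast)
  qed
  then show ?thesis
    using chi_close_mono d(2) assms(3,4) by (metis less_imp_le)
qed

lemma cu_dist_le_if_chi_close:
  assumes "chi_close e \<phi> \<psi>" "0 \<le> e" "e \<le> 1"
  shows "cu_dist \<phi> \<psi> \<le> e"
  unfolding cu_dist_def
  by (rule cInf_lower) (use assms in \<open>auto simp: chi_close_def intro!: bdd_belowI[of _ 0]\<close>)

lemma cu_dist_nonneg:
  assumes "cu_morphism \<phi>" "cu_morphism \<psi>"
  shows "0 \<le> cu_dist \<phi> \<psi>"
proof -
  let ?E = "{e \<in> {0..1}. \<forall>t\<in>{0..1}. \<phi> (chi (t + e)) \<le> \<psi> (chi t) \<and> \<psi> (chi (t + e)) \<le> \<phi> (chi t)}"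
  have "\<phi> 0 = 0" "\<psi> 0 = 0"
    using assms by (simp_all add: cu_morphism_zero)
  then have "1 \<in> ?E"
    by (auto simp: chi_ge_1 pom_zero_le)
  then have "?E \<noteq> {}" by blast
  then show ?thesis
    unfolding cu_dist_def by (rule cInf_greatest) (simp only: mem_Collect_eq atLeastAtMost_iff)
qed

section \<open>Closeness controls all lower-semicontinuous functions\<close>

text \<open>The grid starts at \<open>- h\<close>, so for \<open>s < h\<close> the term with
  \<open>j = 0\<close> is a multiple of the constant 1, and the step function need not vanish at
  0.\<close>

definition step_sum :: "nat \<Rightarrow> real \<Rightarrow> (nat \<Rightarrow> nat) \<Rightarrow> real \<Rightarrow> lsc01" where
  "step_sum M h p s = (\<Sum>j<M. \<Sum>i<p j. chi ((real j - 1) * h + s))"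

lemma lsc_fun_sum: "lsc_fun (sum f A) x = (\<Sum>i\<in>A. lsc_fun (f i) x)"
  by (induction A rule: infinite_finite_induct) (auto simp: zero_lsc01.rep_eq plus_lsc01.rep_eq)

lemma lsc_fun_step_sum:
  assumes "x \<in> {0..1}" "K \<le> M" "\<And>j. (real j - 1) * h + s < x \<longleftrightarrow> j < K"
  shows "lsc_fun (step_sum M h p s) x = enat (\<Sum>j<K. p j)"
proof -
  have "lsc_fun (step_sum M h p s) x = (\<Sum>j<M. if j < K then enat (p j) else 0)"
    unfolding step_sum_def lsc_fun_sum using assms(1)
    by (intro sum.cong) (auto simp: lsc_fun_chi assms(3) of_nat_eq_enat)
  also have "\<dots> = (\<Sum>j<K. enat (p j))"
    using assms(2) by (intro sum.mono_neutral_cong_right) auto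
  also have "\<dots> = enat (\<Sum>j<K. p j)"
    by (simp flip: of_nat_eq_enat)
  finally show ?thesis .
qed

text \<open>The bound on \<open>M\<close> gives every threshold below \<open>x\<close> an index less
  than \<open>M\<close>, for all shifts smaller than the mesh.\<close>

lemma step_index:
  assumes "0 < h" "x \<in> {0..1}" "- h < s" "s < h" "1 / h + 2 \<le> real M"
  obtains K where "K < M" "\<And>j. (real j - 1) * h + s < x \<longleftrightarrow> j < Suc K"
proof -
  define y where "y = (x - s) / h + 1"
  have eq: "(real j - 1) * h + s < x \<longleftrightarrow> real j < y" for j
    using assms(1) by (simp add: y_def field_simps)
  have "y > 0"
    using assms by (simp add: y_def field_simps)
  have "y \<le> real M"
  proof -
    have "(x - s) / h \<le> (1 + h) / h"
      using assms by (intro divide_right_mono) auto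
    then show ?thesis using assms(1,5) by (simp add: y_def add_divide_distrib)
  qed
  \<comment> \<open>Ceiling minus one rather than floor, because the thresholds lie strictly below
    \<open>x\<close>.\<close>
  define K where "K = nat (\<lceil>y\<rceil> - 1)"
  have K: "int K = \<lceil>y\<rceil> - 1"
    using \<open>y > 0\<close> by (simp add: K_def)
  have "real j < y \<longleftrightarrow> j < Suc K" for j
    using K by linarith
  moreover have "K < M"
    using K \<open>y \<le> real M\<close> by linarith
  ultimately show ?thesis
    using that eq by blast
qed

text \<open>Subtraction of naturals truncates, so the two sums collect the positive and negative
  parts of the increments: a discrete Jordan decomposition.\<close>

lemma sum_increments:
  fixes C :: "nat \<Rightarrow> nat"
  assumes "C 0 = 0"
  shows "(\<Sum>j<K. C (Suc j) - C j) = C K + (\<Sum>j<K. C j - C (Suc j))"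
  by (induction K) (use assms in auto)

text \<open>The increments and the decrements of a grid approximation \<open>c\<close> of \<open>f\<close> are the two
  step sums with coefficients \<open>p\<close> and \<open>m\<close>. Shifting one against the other by less than the mesh
  exceeds \<open>c\<close> by the decrement at a single grid point only, hence stays below \<open>f\<close>.\<close>

lemma step_approximation:
  fixes f :: lsc01
  obtains M d h p m where "h > 0"
    "lsc_approx f n + step_sum M d m 0 \<le> step_sum M d p 0"
    "step_sum M d p (- 2 * h) \<le> f + step_sum M d m h"
proof -
  \<comment> \<open>With a third of the radius in \<open>lsc_approx f n\<close>, the
    \<open>2 * d\<close> window around a grid point within \<open>d\<close> of \<open>x\<close>
    stays within \<open>3 * d\<close> of \<open>x\<close>.\<close>
  define d where "d = inverse (real (Suc n)) / 3"
  have d: "d > 0" and d_eq: "inverse (real (Suc n)) = 3 * d" by (simp_all add: d_def)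
  define M where "M = nat \<lceil>1 / d + 2\<rceil>"
  have M: "1 / d + 2 \<le> real M"
    unfolding M_def by linarith
  define c where "c j = min (enat n) (INF y\<in>{y\<in>{0..1}. \<bar>y - real j * d\<bar> \<le> 2 * d}. lsc_fun f y)" for j
  \<comment> \<open>The leading 0 makes \<open>c 0\<close> the first increment.\<close>
  define C where "C j = (case j of 0 \<Rightarrow> 0 | Suc j \<Rightarrow> the_enat (c j))" for j
  have C_Suc: "enat (C (Suc j)) = c j" for j
    by (cases "c j") (auto simp: C_def c_def min_def split: if_splits)
  have C_0: "C 0 = 0" by (simp add: C_def)
  have below: "enat (C (Suc j)) \<le> lsc_fun f x" if "x \<in> {0..1}" "\<bar>x - real j * d\<bar> \<le> 2 * d" for x j
    unfolding C_Suc c_def using that by (auto intro!: min.coboundedI2 INF_lower)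
  have above: "lsc_fun (lsc_approx f n) x \<le> enat (C (Suc j))"
    if "x \<in> {0..1}" "\<bar>x - real j * d\<bar> \<le> d" for x j
  proof -
    have "{y\<in>{0..1}. \<bar>y - real j * d\<bar> \<le> 2 * d} \<subseteq> {y\<in>{0..1}. dist x y \<le> inverse (real (Suc n))}"
      using that unfolding d_eq dist_real_def by auto
    then show ?thesis
      unfolding C_Suc c_def lsc_approx.rep_eq using that(1)
      by (simp only: if_True) (intro min.mono order_refl INF_superset_mono)
  qed
  define p where "p j = C (Suc j) - C j" for j
  define m where "m j = C j - C (Suc j)" for j
  have pm: "(\<Sum>j<K. p j) = C K + (\<Sum>j<K. m j)" for K
    unfolding p_def m_def using sum_increments[of C, OF C_0] .
  \<comment> \<open>The shifts \<open>- 2 * h\<close> and \<open>h\<close> used below differ by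
    \<open>3 * h < d\<close>, so the positions of a point on the two grids differ by at most
    one.\<close>
  define h where "h = d / 4"
  have "lsc_approx f n + step_sum M d m 0 \<le> step_sum M d p 0"
  proof (rule lsc01_leI)
    fix x :: real assume x: "x \<in> {0..1}"
    obtain K where K: "K < M" "\<And>j. (real j - 1) * d + 0 < x \<longleftrightarrow> j < Suc K"
      using step_index[OF d x _ _ M, of 0] d by auto
    have "\<bar>x - real K * d\<bar> \<le> d"
      using K(2)[of K] K(2)[of "Suc K"] by (auto simp: algebra_simps)
    note above[OF x this]
    then show "lsc_fun (lsc_approx f n + step_sum M d m 0) x \<le> lsc_fun (step_sum M d p 0) x"
      unfolding plus_lsc01.rep_eq lsc_fun_step_sum[OF x Suc_leI[OF K(1)] K(2)] pm
        plus_enat_simps(1)[symmetric]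
      by (rule add_right_mono)
  qed
  moreover have "step_sum M d p (- 2 * h) \<le> f + step_sum M d m h"
  proof (rule lsc01_leI)
    fix x :: real assume x: "x \<in> {0..1}"
    obtain K where K: "K < M" "\<And>j. (real j - 1) * d + (- 2 * h) < x \<longleftrightarrow> j < Suc K"
      using step_index[OF d x _ _ M, of "- 2 * h"] d by (auto simp: h_def)
    obtain L where L: "L < M" "\<And>j. (real j - 1) * d + h < x \<longleftrightarrow> j < Suc L"
      using step_index[OF d x _ _ M, of h] d by (auto simp: h_def)
    have near: "\<bar>x - real K * d\<bar> \<le> 2 * d"
      using K(2)[of K] K(2)[of "Suc K"] d by (auto simp: algebra_simps h_def)
    have "L \<le> K"
      using L(2)[of L] K(2)[of L] d by (auto simp: h_def)
    moreover have "K \<le> Suc L"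
    proof (rule ccontr)
      assume "\<not> K \<le> Suc L"
      then have "(real (Suc L) + 1 - 1) * d \<le> (real K - 1) * d"
        using d by (intro mult_right_mono) auto
      then show False
        using K(2)[of K] L(2)[of "Suc L"] d by (auto simp: h_def algebra_simps)
    qed
    ultimately consider "L = K" | "K = Suc L" by linarith
    then have "enat (\<Sum>j<Suc K. p j) \<le> lsc_fun f x + enat (\<Sum>j<Suc L. m j)"
    proof cases
      case 1
      show ?thesis
        unfolding 1 pm plus_enat_simps(1)[symmetric] using below[OF x near] by (rule add_right_mono)
    next
      case 2
      have "\<bar>x - real L * d\<bar> \<le> 2 * d"
        using K(2)[of K] L(2)[of "Suc L"] d 2 by (auto simp: algebra_simps h_def)
      then have "enat (max (C (Suc K)) (C (Suc L))) \<le> lsc_fun f x"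
        using below[OF x] near by (simp add: max_def)
      \<comment> \<open>The one surplus decrement \<open>m K\<close> raises \<open>C (Suc K)\<close>
        to the maximum of two neighbouring values, both below \<open>f x\<close> because
        \<open>x\<close> is near both grid points.\<close>
      moreover have "(\<Sum>j<Suc K. p j) = max (C (Suc K)) (C (Suc L)) + (\<Sum>j<Suc L. m j)"
        unfolding pm 2 sum.lessThan_Suc[of m "Suc L"] by (simp add: m_def)
      ultimately show ?thesis
        by (metis add_right_mono plus_enat_simps(1))
    qed
    then show "lsc_fun (step_sum M d p (- 2 * h)) x \<le> lsc_fun (f + step_sum M d m h) x"
      unfolding plus_lsc01.rep_eq lsc_fun_step_sum[OF x Suc_leI[OF K(1)] K(2)]
        lsc_fun_step_sum[OF x Suc_leI[OF L(1)] L(2)] .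
  qed
  moreover have "h > 0"
    using d by (simp add: h_def)
  ultimately show ?thesis
    using that by blast
qed

section \<open>Comparison of close morphisms by weak cancellation\<close>

lemma step_sum_chi_close:
  assumes "cu_morphism \<phi>" "cu_morphism \<psi>" "chi_close e \<phi> \<psi>"
  shows "\<phi> (step_sum M d p (s + e)) \<le> \<psi> (step_sum M d p s)"
proof -
  have "\<phi> (chi (t + (s + e))) \<le> \<psi> (chi (t + s))" for t
    using assms(3) unfolding chi_close_def by (metis add.assoc)
  then show ?thesis
    unfolding step_sum_def cu_morphism_sum[OF assms(1)] cu_morphism_sum[OF assms(2)]
    by (intro sum_mono)
qed

text \<open>The \<open>e\<close> is the \<open>h\<close> of \<open>step_approximation\<close>,
  chosen before the morphisms. Closeness costs one shift by \<open>h\<close> for the sum over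
  \<open>p\<close>, passing from \<open>\<phi>\<close> to \<open>\<psi>\<close>, and one for the sum
  over \<open>m\<close>, passing back.\<close>

lemma chi_close_imp_le:
  assumes wc: "weakly_cancellative TYPE('s::cu_semigroup)" and "f' \<lless> f"
  shows "\<exists>e>0. \<forall>\<phi> \<psi> :: lsc01 \<Rightarrow> 's. cu_morphism \<phi> \<longrightarrow> cu_morphism \<psi> \<longrightarrow> chi_close e \<phi> \<psi> \<longrightarrow>
    \<phi> f' \<le> \<psi> f"
proof -
  obtain n where n: "f' \<le> lsc_approx f n"
    using way_below_lsc_approxD[OF assms(2)] by blast
  obtain M d h p m where h: "h > 0"
    and lower: "lsc_approx f n + step_sum M d m 0 \<le> step_sum M d p 0"
    and upper: "step_sum M d p (- 2 * h) \<le> f + step_sum M d m h"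
    by (rule step_approximation)
  have "\<phi> f' \<le> \<psi> f" if \<phi>: "cu_morphism \<phi>" and \<psi>: "cu_morphism \<psi>" and close: "chi_close h \<phi> \<psi>"
    for \<phi> \<psi> :: "lsc01 \<Rightarrow> 's"
  proof -
    have "\<phi> f' + \<phi> (step_sum M d m 0) = \<phi> (f' + step_sum M d m 0)"
      by (rule cu_morphism_add[OF \<phi>, symmetric])
    also have "\<dots> \<le> \<phi> (step_sum M d p 0)"
      by (intro cu_morphism_mono[OF \<phi>] order_trans[OF add_right_mono[OF n] lower])
    finally have 1: "\<phi> f' + \<phi> (step_sum M d m 0) \<le> \<phi> (step_sum M d p 0)" .
    \<comment> \<open>Weak cancellation starts from \<open>\<lless>\<close>; lowering all thresholds
      by a further \<open>h\<close> supplies it.\<close>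
    have "step_sum M d p 0 \<lless> step_sum M d p (- h)"
      unfolding step_sum_def using h by (intro sum_way_below chi_way_below) auto
    then have 2: "\<phi> (step_sum M d p 0) \<lless> \<phi> (step_sum M d p (- h))"
      using \<phi> unfolding cu_morphism_def by blast
    have "\<phi> (step_sum M d p (- h)) \<le> \<psi> (step_sum M d p (- 2 * h))"
      using step_sum_chi_close[OF \<phi> \<psi> close, of M d p "- 2 * h"] by simp
    also have "\<dots> \<le> \<psi> (f + step_sum M d m h)"
      using upper by (rule cu_morphism_mono[OF \<psi>])
    also have "\<dots> = \<psi> f + \<psi> (step_sum M d m h)"
      by (rule cu_morphism_add[OF \<psi>])
    also have "\<dots> \<le> \<psi> f + \<phi> (step_sum M d m 0)"
      using step_sum_chi_close[OF \<psi> \<phi> chi_close_sym[OF close], of M d m 0]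
      by (intro add_left_mono) simp
    finally have "\<phi> f' + \<phi> (step_sum M d m 0) \<lless> \<psi> f + \<phi> (step_sum M d m 0)"
      using 1 2 le_way_below_trans way_below_le_trans by blast
    then show ?thesis
      using wc way_below_imp_le unfolding weakly_cancellative_def by blast
  qed
  with h show ?thesis by blast
qed

lemma eq_if_chi_close:
  fixes \<phi> \<psi> :: "lsc01 \<Rightarrow> 's::cu_semigroup"
  assumes wc: "weakly_cancellative TYPE('s)" and "cu_morphism \<phi>" "cu_morphism \<psi>"
    and "\<And>e. e > 0 \<Longrightarrow> chi_close e \<phi> \<psi>"
  shows "\<phi> = \<psi>"
proof -
  have le: "\<phi> f \<le> \<psi> f"
    if "cu_morphism \<phi>" "cu_morphism \<psi>" "\<And>e. e > 0 \<Longrightarrow> chi_close e \<phi> \<psi>"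
    for f and \<phi> \<psi> :: "lsc01 \<Rightarrow> 's"
  proof -
    obtain z where z: "\<And>n. z n \<lless> f" "incseq z" "is_supremum z f"
      using way_below_approximation[of f] by metis
    have "\<phi> (z n) \<le> \<psi> f" for n
      using chi_close_imp_le[OF wc z(1)] that by blast
    moreover have "is_supremum (\<lambda>n. \<phi> (z n)) (\<phi> f)"
      using that(1) z(2,3) unfolding cu_morphism_def by blast
    ultimately show ?thesis
      unfolding is_supremum_def by blast
  qed
  show ?thesis
    using le assms(2-4) chi_close_sym by (intro ext antisym) blast+
qed

lemma ex_chi_close_limit:
  fixes \<phi> :: "nat \<Rightarrow> lsc01 \<Rightarrow> 's::cu_semigroup"
  assumes wc: "weakly_cancellative TYPE('s)" and \<phi>: "\<And>i. cu_morphism (\<phi> i)"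
    and cauchy: "\<And>e. e > 0 \<Longrightarrow> \<exists>N. \<forall>i\<ge>N. \<forall>j\<ge>N. chi_close e (\<phi> i) (\<phi> j)"
  obtains \<psi> where "cu_morphism \<psi>" "\<And>e. e > 0 \<Longrightarrow> \<forall>\<^sub>F i in sequentially. chi_close e \<psi> (\<phi> i)"
proof -
  have le: "\<exists>N. \<forall>i\<ge>N. \<forall>j\<ge>N. \<phi> i f' \<le> \<phi> j f" if way_below: "f' \<lless> f" for f' f
  proof -
    obtain e where e: "e > 0"
      "\<And>\<phi> \<psi> :: lsc01 \<Rightarrow> 's. cu_morphism \<phi> \<Longrightarrow> cu_morphism \<psi> \<Longrightarrow> chi_close e \<phi> \<psi> \<Longrightarrow> \<phi> f' \<le> \<psi> f"
      using chi_close_imp_le[OF wc way_below] by metis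
    then show ?thesis
      using cauchy[OF e(1)] \<phi> by blast
  qed
  define \<psi> where "\<psi> = cu_lim \<phi>"
  note upper = eventually_le_cu_lim[of \<phi>, OF \<phi> le, folded \<psi>_def]
  note lower = eventually_cu_lim_le[of \<phi>, OF \<phi> le, folded \<psi>_def]
  have "\<forall>\<^sub>F i in sequentially. chi_close e \<psi> (\<phi> i)" if "e > 0" for e
  proof -
    obtain N where N: "\<And>i j. i \<ge> N \<Longrightarrow> j \<ge> N \<Longrightarrow> chi_close (e / 2) (\<phi> i) (\<phi> j)"
      using cauchy[of "e / 2"] \<open>e > 0\<close> by (metis half_gt_zero)
    have "chi_close e \<psi> (\<phi> i)" if i: "i \<ge> N" for i
      unfolding chi_close_def
    proof (intro allI conjI)
      fix t
      \<comment> \<open>Half of \<open>e\<close> pays for passing between \<open>\<psi>\<close> and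
        \<open>\<phi> j\<close>, the other half for passing from \<open>\<phi> j\<close> to
        \<open>\<phi> i\<close>. The index \<open>j\<close> depends on \<open>t\<close>, but
        \<open>N\<close> does not.\<close>
      have chi: "chi (t + e) \<lless> chi (t + e / 2)" "chi (t + e / 2) \<lless> chi t"
        using \<open>e > 0\<close> by (auto intro: chi_way_below)
      have "\<forall>\<^sub>F j in sequentially. j \<ge> N \<and> \<psi> (chi (t + e)) \<le> \<phi> j (chi (t + e / 2)) \<and>
          \<phi> j (chi (t + e / 2)) \<le> \<psi> (chi t)"
        by (intro eventually_conj eventually_ge_at_top upper lower chi)
      then obtain j where j: "j \<ge> N" "\<psi> (chi (t + e)) \<le> \<phi> j (chi (t + e / 2))"
          "\<phi> j (chi (t + e / 2)) \<le> \<psi> (chi t)"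
        using eventually_happens'[of sequentially] by auto
      have "\<phi> j (chi (t + e / 2)) \<le> \<phi> i (chi t)"
          "\<phi> i (chi (t + e / 2 + e / 2)) \<le> \<phi> j (chi (t + e / 2))"
        using N[OF i j(1)] unfolding chi_close_def by blast+
      with j show "\<psi> (chi (t + e)) \<le> \<phi> i (chi t)" "\<phi> i (chi (t + e)) \<le> \<psi> (chi t)"
        by (simp_all add: add.assoc)
    qed
    then show ?thesis
      unfolding eventually_sequentially by blast
  qed
  moreover have "cu_morphism \<psi>"
    unfolding \<psi>_def by (rule cu_morphism_cu_lim[of \<phi>, OF \<phi> le])
  ultimately show ?thesis
    using that by blast
qed

section \<open>Sequences with summable distances\<close>

lemma chi_close_sum:
  assumes "\<And>i. chi_close (e i) (\<phi> i) (\<phi> (Suc i))" "cu_morphism (\<phi> m)" "m \<le> n"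
  shows "chi_close (sum e {m..<n}) (\<phi> m) (\<phi> n)"
  using assms(3)
proof (induction n rule: dec_induct)
  case base
  then show ?case using chi_close_refl[OF assms(2)] by simp
next
  case (step n)
  then show ?case using chi_close_trans[OF _ assms(1)] by simp
qed

text \<open>Closeness is evaluated at a \<open>t\<close> so negative that both \<open>chi t\<close>
  and \<open>chi (t + e)\<close> are 1.\<close>

lemma chi_close_imp_one_eq: "chi_close e \<phi> \<psi> \<Longrightarrow> \<phi> 1 = \<psi> 1"
proof -
  assume "chi_close e \<phi> \<psi>"
  moreover have "chi (- 1 - \<bar>e\<bar>) = 1" "chi (- 1 - \<bar>e\<bar> + e) = 1"
    by (simp_all add: chi_neg)
  ultimately show ?thesis
    unfolding chi_close_def by (metis antisym)
qed

theorem theorem2: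
  fixes \<phi> :: "nat \<Rightarrow> lsc01 \<Rightarrow> 's::cu_semigroup"
    and \<epsilon> :: "nat \<Rightarrow> real"
  assumes "weakly_cancellative TYPE('s)"
    and "satisfies_O5 TYPE('s)"
    and "\<And>i. i \<ge> 1 \<Longrightarrow> cu_morphism (\<phi> i)"
    and "\<And>i. i \<ge> 1 \<Longrightarrow> \<phi> i 1 = \<phi> (Suc i) 1"
    and "\<And>i. i \<ge> 1 \<Longrightarrow> cu_dist (\<phi> i) (\<phi> (Suc i)) < \<epsilon> i"
    and "\<And>i j. 1 \<le> i \<Longrightarrow> i < j \<Longrightarrow> \<epsilon> j < \<epsilon> i"
    and "summable (\<lambda>i. \<epsilon> (Suc i))"
  shows "\<exists>!\<psi>. cu_morphism \<psi> \<and>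
           (\<lambda>i. cu_dist \<psi> (\<phi> i)) \<longlonglongrightarrow> 0 \<and>
           (\<forall>i\<ge>1. \<psi> 1 = \<phi> i 1)"
proof -
  \<comment> \<open>Reindexing from 0 makes the hypotheses available at every index.\<close>
  define \<Phi> where "\<Phi> i = \<phi> (Suc i)" for i
  define e where "e i = \<epsilon> (Suc i)" for i
  have morphism: "cu_morphism (\<Phi> i)" for i
    unfolding \<Phi>_def using assms(3) by simp
  have step: "chi_close (e i) (\<Phi> i) (\<Phi> (Suc i))" for i
    unfolding \<Phi>_def e_def by (intro chi_close_if_cu_dist_less assms(3-5)) simp_all
  have cauchy: "\<exists>N. \<forall>i\<ge>N. \<forall>j\<ge>N. chi_close \<delta> (\<Phi> i) (\<Phi> j)" if "\<delta> > 0" for \<delta>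
  proof -
    have "summable e"
      using assms(7) by (simp add: e_def[abs_def])
    then obtain N where N: "\<And>m n. m \<ge> N \<Longrightarrow> norm (sum e {m..<n}) < \<delta>"
      unfolding summable_Cauchy using \<open>\<delta> > 0\<close> by blast
    \<comment> \<open>Closeness parameters add along the sequence, so a tail sum of \<open>e\<close>
      bounds the total.\<close>
    have "chi_close \<delta> (\<Phi> i) (\<Phi> j)" if "N \<le> i" "i \<le> j" for i j
    proof (rule chi_close_mono[OF chi_close_sum[of e \<Phi>, OF step morphism that(2)] _ morphism morphism])
      show "sum e {i..<j} \<le> \<delta>"
        using N[OF that(1), of j] by simp
    qed
    then show ?thesis
      by (meson chi_close_sym nle_le)
  qed
  have one: "\<phi> i 1 = \<phi> 1 1" if "i \<ge> 1" for i
    using that by (induction i rule: dec_induct) (simp_all flip: assms(4))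
  obtain \<psi> where \<psi>: "cu_morphism \<psi>" "\<And>e. e > 0 \<Longrightarrow> \<forall>\<^sub>F i in sequentially. chi_close e \<psi> (\<Phi> i)"
    using ex_chi_close_limit[of \<Phi>, OF assms(1) morphism cauchy] by metis
  have "(\<lambda>i. cu_dist \<psi> (\<Phi> i)) \<longlonglongrightarrow> 0"
  proof (rule tendstoI)
    fix \<delta> :: real assume "\<delta> > 0"
    \<comment> \<open>The minimum with 1 keeps \<open>r\<close> in the range of the infimum defining
      \<open>cu_dist\<close>; halving gives the strict inequality.\<close>
    define r where "r = min 1 (\<delta> / 2)"
    have r: "0 < r" "r \<le> 1" "r < \<delta>"
      using \<open>\<delta> > 0\<close> by (auto simp: r_def)
    show "\<forall>\<^sub>F i in sequentially. dist (cu_dist \<psi> (\<Phi> i)) 0 < \<delta>"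
      using \<psi>(2)[OF r(1)]
    proof eventually_elim
      case (elim i)
      then show ?case
        using cu_dist_le_if_chi_close[OF elim] cu_dist_nonneg[OF \<psi>(1) morphism[of i]] r by simp
    qed
  qed
  then have lim: "(\<lambda>i. cu_dist \<psi> (\<phi> i)) \<longlonglongrightarrow> 0"
    unfolding \<Phi>_def by (rule LIMSEQ_imp_Suc)
  obtain i where "chi_close 1 \<psi> (\<Phi> i)"
    using eventually_happens'[OF _ \<psi>(2)[of 1]] by auto
  then have "\<psi> 1 = \<phi> (Suc i) 1"
    unfolding \<Phi>_def by (rule chi_close_imp_one_eq)
  also have "\<dots> = \<phi> 1 1"
    by (rule one) simp
  finally have \<psi>_one: "\<forall>j\<ge>1. \<psi> 1 = \<phi> j 1"
    using one by metis
  have unique: "\<theta> = \<psi>" if \<theta>: "cu_morphism \<theta>" "(\<lambda>i. cu_dist \<theta> (\<phi> i)) \<longlonglongrightarrow> 0" "\<forall>i\<ge>1. \<theta> 1 = \<phi> i 1"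
    for \<theta>
  proof (rule eq_if_chi_close[OF assms(1) \<theta>(1) \<psi>(1)])
    fix \<delta> :: real assume "\<delta> > 0"
    have "\<forall>\<^sub>F i in sequentially. cu_dist \<theta> (\<Phi> i) < \<delta> / 2"
      unfolding \<Phi>_def
      by (rule order_tendstoD(2)[OF LIMSEQ_Suc[OF \<theta>(2)]]) (use \<open>\<delta> > 0\<close> in simp)
    then have "\<forall>\<^sub>F i in sequentially. cu_dist \<theta> (\<Phi> i) < \<delta> / 2 \<and> chi_close (\<delta> / 2) \<psi> (\<Phi> i)"
      using \<psi>(2)[of "\<delta> / 2"] \<open>\<delta> > 0\<close> by (simp add: eventually_conj)
    then obtain i where i: "cu_dist \<theta> (\<Phi> i) < \<delta> / 2" "chi_close (\<delta> / 2) \<psi> (\<Phi> i)"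
      using eventually_happens'[of sequentially] by auto
    have "\<theta> 1 = \<Phi> i 1"
      unfolding \<Phi>_def by (rule \<theta>(3)[rule_format]) simp
    from chi_close_trans[OF chi_close_if_cu_dist_less[OF i(1) this \<theta>(1) morphism]
        chi_close_sym[OF i(2)]]
    show "chi_close \<delta> \<theta> \<psi>" by simp
  qed
  show ?thesis
    using \<psi>(1) lim \<psi>_one unique by (intro ex1I[of _ \<psi>] conjI) blast+
qed

end
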